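(* Let $D=\{\delta_1,\ldots,\delta_N\}\subset(0,1)$ with $\delta_i\neq\delta_j$ for $i\neq j$, and let $\succeq$ be a weak order on $\ell_\infty$. The following conditions are equivalent. (i) The relation $\succeq$ satisfies D-monotonicity (a), Continuity, Convexity (parts (a) and (b)), and Invariance with respect to common origins. (ii) There exists a grounded, convex, lower semi-continuous, and nondegenerate function $c:\Delta(D)\to[0,\infty]$ such that for all $x,y\in\ell_\infty$, $$x\succeq y \iff \min_{\mu\in\Delta(D)}\left(\sum_{\delta\in D}(1-\delta)\langle\delta,x\rangle\mu(\delta)+c(\mu)\right)\geq \min_{\mu\in\Delta(D)}\left(\sum_{\delta\in D}(1-\delta)\langle\delta,y\rangle\mu(\delta)+c(\mu)\right).$$
   Context: $\mathbb{T}=\{0,1,2,\ldots\}$. $\ell_\infty$ is the space of bounded real sequences $x=(x_t)_{t\in\mathbb{T}}$ with the supremum norm $\|x\|_\infty=\sup_t|x_t|$. For $\delta\in(0,1)$, $\langle\delta,x\rangle=\sum_{t\in\mathbb{T}}\delta^t x_t$. A weak order is a complete and transitive binary relation; $\succ$ and $\sim$ are the asymmetric and symmetric parts of $\succeq$. A scalar $\theta\in\mathbb{R}$ also denotes the constant stream $(\theta,\theta,\ldots)$. $\Delta(D)$ is the set of probability measures on the finite set $D$ (identified with the standard simplex in $\mathbb{R}^N$). A function $c:\Delta(D)\to[0,\infty]$ is grounded if $\inf_{\mu\in\Delta(D)}c(\mu)=0$, and nondegenerate if there are at least two distinct $\mu\in\Delta(D)$ with $c(\mu)<\infty$. Axioms: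 - D-monotonicity (a): for all $x,y\in\ell_\infty$, if $\langle\delta,x\rangle\geq\langle\delta,y\rangle$ for all $\delta\in D$, then $x\succeq y$. - Continuity: for every $x\in\ell_\infty$, the sets $\{z\in\ell_\infty: z\succeq x\}$ and $\{z\in\ell_\infty: x\succeq z\}$ are closed. - Convexity: (a) for all $x,y\in\ell_\infty$, if $x\sim y$, then $\alpha x+(1-\alpha)y\succeq x$ for every $\alpha\in[0,1]$; and (b) there exist $x',y'\in\ell_\infty$ with $x'\sim y'$ and $\alpha x'+(1-\alpha)y'\succ x'$ for some $\alpha\in(0,1)$. - Invariance with respect to common origins: for all $x,y\in\ell_\infty$ and all constant streams $\theta$, $x\succeq y$ if and only if $x+\theta\succeq y+\theta$. *)

theory Defs
  imports "HOL-Analysis.Analysis"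
begin

text \<open>
  The topology of \<^typ>\<open>nat\<close> is discrete, so the bounded continuous functions on \<^typ>\<open>nat\<close> are
  exactly the bounded sequences, and their metric and norm are those of the supremum norm.
\<close>

type_synonym stream = "nat \<Rightarrow>\<^sub>C real"

abbreviation constant_stream :: "real \<Rightarrow> stream" where
  "constant_stream \<equiv> const_bcontfun"

definition discounted_sum :: "real \<Rightarrow> stream \<Rightarrow> real" where
  "discounted_sum d x = (\<Sum>t. d ^ t * apply_bcontfun x t)"

type_synonym preference = "stream \<Rightarrow> stream \<Rightarrow> bool"

definition weak_order :: "preference \<Rightarrow> bool" where
  "weak_order R \<longleftrightarrow> (\<forall>x y. R x y \<or> R y x) \<and> transp R"

definition strict_part :: "preference \<Rightarrow> preference" where
  "strict_part R x y \<longleftrightarrow> R x y \<and> \<not> R y x"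

definition indifference :: "preference \<Rightarrow> preference" where
  "indifference R x y \<longleftrightarrow> R x y \<and> R y x"

definition D_monotonicity_a :: "real set \<Rightarrow> preference \<Rightarrow> bool" where
  "D_monotonicity_a D R \<longleftrightarrow>
    (\<forall>x y. (\<forall>d\<in>D. discounted_sum d x \<ge> discounted_sum d y) \<longrightarrow> R x y)"

definition continuity :: "preference \<Rightarrow> bool" where
  "continuity R \<longleftrightarrow> (\<forall>x. closed {z. R z x} \<and> closed {z. R x z})"

definition convexity_a :: "preference \<Rightarrow> bool" where
  "convexity_a R \<longleftrightarrow>
    (\<forall>x y. indifference R x y \<longrightarrow> (\<forall>\<alpha>\<in>{0..1}. R (\<alpha> *\<^sub>R x + (1 - \<alpha>) *\<^sub>R y) x))"

definition convexity_b :: "preference \<Rightarrow> bool" where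
  "convexity_b R \<longleftrightarrow>
    (\<exists>x y. indifference R x y \<and>
      (\<exists>\<alpha>\<in>{0<..<1}. strict_part R (\<alpha> *\<^sub>R x + (1 - \<alpha>) *\<^sub>R y) x))"

definition common_origin_invariance :: "preference \<Rightarrow> bool" where
  "common_origin_invariance R \<longleftrightarrow>
    (\<forall>x y \<theta>. R x y \<longleftrightarrow> R (x + constant_stream \<theta>) (y + constant_stream \<theta>))"

text \<open>
  A finite set \<open>D\<close> with \<open>N\<close> elements is enumerated without repetition by an index type \<open>'n\<close>
  with \<open>N\<close> elements, and \<open>\<mu> $ i\<close> is the mass that a probability measure \<open>\<mu>\<close> on \<open>D\<close>
  puts on the element with index \<open>i\<close>.
\<close>

definition prob_simplex :: "(real ^ 'n::finite) set" where
  "prob_simplex = {\<mu>. (\<forall>i. 0 \<le> \<mu> $ i) \<and> (\<Sum>i\<in>UNIV. \<mu> $ i) = 1}"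

text \<open>
  Functions from \<open>\<Delta>(D)\<close> to \<open>[0,\<infinity>]\<close> are rendered by functions on all of \<open>\<real>\<^sup>N\<close> of which
  only the values on \<^const>\<open>prob_simplex\<close> are used. In \<^typ>\<open>ennreal\<close>, \<open>0 * \<infinity> = 0\<close>.
\<close>

definition grounded :: "(real ^ 'n::finite \<Rightarrow> ennreal) \<Rightarrow> bool" where
  "grounded c \<longleftrightarrow> (INF \<mu>\<in>prob_simplex. c \<mu>) = 0"

definition convex_cost :: "(real ^ 'n::finite \<Rightarrow> ennreal) \<Rightarrow> bool" where
  "convex_cost c \<longleftrightarrow>
    (\<forall>\<mu>\<in>prob_simplex. \<forall>\<nu>\<in>prob_simplex. \<forall>\<alpha>\<in>{0..1}.
      c (\<alpha> *\<^sub>R \<mu> + (1 - \<alpha>) *\<^sub>R \<nu>) \<le> ennreal \<alpha> * c \<mu> + ennreal (1 - \<alpha>) * c \<nu>)"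

definition lower_semicontinuous_cost :: "(real ^ 'n::finite \<Rightarrow> ennreal) \<Rightarrow> bool" where
  "lower_semicontinuous_cost c \<longleftrightarrow>
    (\<forall>\<mu>\<in>prob_simplex. \<forall>a. a < c \<mu> \<longrightarrow> (\<forall>\<^sub>F \<nu> in at \<mu> within prob_simplex. a < c \<nu>))"

definition nondegenerate :: "(real ^ 'n::finite \<Rightarrow> ennreal) \<Rightarrow> bool" where
  "nondegenerate c \<longleftrightarrow>
    (\<exists>\<mu>\<in>prob_simplex. \<exists>\<nu>\<in>prob_simplex. \<mu> \<noteq> \<nu> \<and> c \<mu> < \<infinity> \<and> c \<nu> < \<infinity>)"

text \<open>
  The least element below is the minimum over \<open>\<Delta>(D)\<close>. It exists whenever \<open>c\<close> is lower
  semicontinuous, because \<^const>\<open>prob_simplex\<close> is compact and nonempty.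
\<close>

definition variational_value ::
    "('n::finite \<Rightarrow> real) \<Rightarrow> (real ^ 'n \<Rightarrow> ennreal) \<Rightarrow> stream \<Rightarrow> ereal" where
  "variational_value \<delta> c x =
    (LEAST v. v \<in> (\<lambda>\<mu>. ereal (\<Sum>i\<in>UNIV. (1 - \<delta> i) * discounted_sum (\<delta> i) x * \<mu> $ i)
                          + enn2ereal (c \<mu>)) ` prob_simplex)"

end

theory Submission
  imports Defs "HOL-Computational_Algebra.Polynomial"
begin

text \<open>
  By monotonicity a preference depends only on the vector of normalised discounted sums, and
  Lagrange interpolation shows that every vector in \<open>\<real>\<^sup>N\<close> arises from a stream. The axioms then say
  that the certainty equivalent is a monotone, concave and translation invariant function \<open>f\<close> on
  \<open>\<real>\<^sup>N\<close> with \<open>f 0 = 0\<close>, and convexity (b) says that \<open>f\<close> is not odd, since a concave odd function is linear.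
  Monotonicity and translation invariance force the supergradients of \<open>f\<close> into the simplex, so \<open>f\<close>
  is the minimum of \<open>\<mu> \<bullet> v + c \<mu>\<close> over the simplex, where \<open>c \<mu>\<close> is the supremum of
  \<open>f v - \<mu> \<bullet> v\<close> over all \<open>v\<close>. In such a representation \<open>f\<close> is odd exactly if \<open>c\<close> is finite at a single point.
\<close>

subsection \<open>Discounted profiles of streams\<close>

lemma summable_discounted:
  fixes x :: stream
  assumes "d \<in> {0<..<1}"
  shows "summable (\<lambda>t. d ^ t * apply_bcontfun x t)"
proof (rule summable_comparison_test)
  show "summable (\<lambda>t. norm x * d ^ t)"
    using assms by (intro summable_mult summable_geometric) auto
  show "\<exists>N. \<forall>n\<ge>N. norm (d ^ n * apply_bcontfun x n) \<le> norm x * d ^ n"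
    using assms norm_bounded[of x]
    by (auto simp: abs_mult power_abs mult.commute intro!: mult_mono)
qed

lemma bounded_linear_discounted_sum:
  assumes "d \<in> {0<..<1}"
  shows "bounded_linear (discounted_sum d)"
proof (rule bounded_linear_intro)
  note s = summable_discounted[OF assms]
  show "discounted_sum d (x + y) = discounted_sum d x + discounted_sum d y" for x y
    unfolding discounted_sum_def suminf_add[OF s s] by (simp add: distrib_left)
  show "discounted_sum d (r *\<^sub>R x) = r *\<^sub>R discounted_sum d x" for r x
    unfolding discounted_sum_def using suminf_mult[OF s, of r x] by (simp add: mult.left_commute)
  show "norm (discounted_sum d x) \<le> norm x * (1 / (1 - d))" for x
  proof -
    have g: "summable (\<lambda>t. norm x * d ^ t)"
      using assms by (intro summable_mult summable_geometric) auto
    have "norm (discounted_sum d x) \<le> (\<Sum>t. norm x * d ^ t)"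
      unfolding discounted_sum_def
      by (rule norm_suminf_le[OF _ g])
        (use assms norm_bounded[of x] in \<open>auto simp: abs_mult power_abs mult.commute intro!: mult_mono\<close>)
    also have "\<dots> = norm x * (1 / (1 - d))"
      using assms by (subst suminf_mult) (auto simp: suminf_geometric summable_geometric)
    finally show ?thesis .
  qed
qed

lemma discounted_sum_constant_stream:
  assumes "d \<in> {0<..<1}"
  shows "(1 - d) * discounted_sum d (constant_stream t) = t"
  using assms
  by (simp add: discounted_sum_def const_bcontfun.rep_eq suminf_mult2[symmetric]
      suminf_geometric summable_geometric)

text \<open>The factor \<open>1 - \<delta> i\<close> sends the constant stream t to
  \<open>vec t\<close>, so a change of common origin becomes a translation along the
  diagonal.\<close>

definition profile :: "('n::finite \<Rightarrow> real) \<Rightarrow> stream \<Rightarrow> real ^ 'n" where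
  "profile \<delta> x = (\<chi> i. (1 - \<delta> i) * discounted_sum (\<delta> i) x)"

lemma bounded_linear_profile:
  assumes "range \<delta> \<subseteq> {0<..<1}"
  shows "bounded_linear (profile \<delta>)"
proof -
  have "bounded_linear (discounted_sum (\<delta> i))" for i
    using assms by (intro bounded_linear_discounted_sum) blast
  then have "bounded_linear (\<lambda>x. profile \<delta> x \<bullet> b)" if "b \<in> Basis" for b
    using that bounded_linear_const_mult by (force simp: profile_def Basis_vec_def inner_axis)
  then have "bounded_linear (\<lambda>x. \<Sum>b\<in>Basis. (profile \<delta> x \<bullet> b) *\<^sub>R b)"
    by (intro bounded_linear_sum bounded_linear_scaleR_const)
  then show ?thesis
    by (simp add: euclidean_representation)
qed

lemma profile_constant_stream:
  assumes "range \<delta> \<subseteq> {0<..<1}"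
  shows "profile \<delta> (constant_stream t) = vec t"
  using assms by (auto simp: profile_def vec_eq_iff intro!: discounted_sum_constant_stream)

text \<open>The coefficients of a polynomial form a finitely supported, hence bounded, stream, and
  discounting it evaluates the polynomial at the discount factor. Prescribing discounted sums thus
  becomes an interpolation problem.\<close>

lemma poly_coeff_stream:
  fixes p :: "real poly"
  obtains x :: stream where "\<And>d. discounted_sum d x = poly p d"
proof
  have "coeff p \<in> bcontfun"
    unfolding bcontfun_def
  proof (intro CollectI conjI)
    show "continuous_on UNIV (coeff p)"
      by simp
    have "range (coeff p) \<subseteq> insert 0 (coeff p ` {..degree p})"
      by (auto simp: image_iff) (metis coeff_eq_0 linorder_not_less atMost_iff)
    then show "bounded (range (coeff p))"
      by (meson finite.insertI finite_atMost finite_imageI finite_imp_bounded finite_subset)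
  qed
  then have "apply_bcontfun (Bcontfun (coeff p)) = coeff p"
    by (rule Bcontfun_inverse)
  moreover have "(\<Sum>t. d ^ t * coeff p t) = (\<Sum>t\<le>degree p. d ^ t * coeff p t)" for d
    by (rule suminf_finite) (auto simp: coeff_eq_0)
  ultimately show "discounted_sum d (Bcontfun (coeff p)) = poly p d" for d
    by (simp add: discounted_sum_def poly_altdef mult.commute)
qed

lemma profile_section:
  fixes \<delta> :: "'n::finite \<Rightarrow> real"
  assumes D: "range \<delta> \<subseteq> {0<..<1}" and "inj \<delta>"
  obtains S :: "real ^ 'n \<Rightarrow> stream" where "\<And>v. profile \<delta> (S v) = v"
proof -
  have "\<exists>x. profile \<delta> x = v" for v
  proof -
    \<comment> \<open>The Lagrange basis polynomials for the nodes \<open>\<delta> j\<close>;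
      injectivity of \<open>\<delta>\<close> keeps the denominators nonzero.\<close>
    define q where "q i = (\<Prod>j\<in>UNIV - {i}. smult (1 / (\<delta> i - \<delta> j)) [:- \<delta> j, 1:])" for i
    have q: "poly (q i) (\<delta> k) = (if i = k then 1 else 0)" for i k
      unfolding q_def poly_prod
      using \<open>inj \<delta>\<close>
      by (auto simp: inj_eq right_diff_distrib[symmetric] divide_simps intro!: prod.neutral)
    \<comment> \<open>The weights \<open>v $ i / (1 - \<delta> i)\<close> undo the normalisation in
      \<open>profile\<close>.\<close>
    obtain x :: stream
      where x: "\<And>d. discounted_sum d x = poly (\<Sum>i\<in>UNIV. smult (v $ i / (1 - \<delta> i)) (q i)) d"
      using poly_coeff_stream by blast
    have "1 - \<delta> k \<noteq> 0" for k
      using D by (metis eq_iff_diff_eq_0 greaterThanLessThan_iff less_irrefl rangeI subsetD)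
    then have "profile \<delta> x = v"
      by (simp add: profile_def vec_eq_iff x poly_sum q if_distrib cong: if_cong)
    then show ?thesis ..
  qed
  then show ?thesis
    by (metis that)
qed

subsection \<open>Concave niveloids\<close>

text \<open>A niveloid is a monotone translation invariant functional. With \<open>f 0 = 0\<close>
  it satisfies \<open>f (vec t) = t\<close>, so its values are certainty equivalents.\<close>

definition concave_niveloid :: "(real ^ 'n::finite \<Rightarrow> real) \<Rightarrow> bool" where
  "concave_niveloid f \<longleftrightarrow>
    (\<forall>v w. (\<forall>i. v $ i \<le> w $ i) \<longrightarrow> f v \<le> f w) \<and>
    (\<forall>v t. f (v + vec t) = f v + t) \<and> concave_on UNIV f \<and> f 0 = 0"

lemma concave_niveloid_mixture:
  assumes "concave_niveloid f" "\<alpha> \<in> {0..1}"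
  shows "\<alpha> * f v + (1 - \<alpha>) * f w \<le> f (\<alpha> *\<^sub>R v + (1 - \<alpha>) *\<^sub>R w)"
  using assms concave_onD[of UNIV f "1 - \<alpha>" v w] by (simp add: concave_niveloid_def)

lemma prob_simplex_inner_vec:
  assumes "\<mu> \<in> prob_simplex"
  shows "\<mu> \<bullet> vec t = t"
  using assms by (simp add: prob_simplex_def inner_vec_def flip: sum_distrib_right)

lemma compact_prob_simplex: "compact (prob_simplex :: (real ^ 'n::finite) set)"
proof (rule compact_eq_bounded_closed[THEN iffD2], rule conjI)
  have "norm \<mu> \<le> 1" if "\<mu> \<in> prob_simplex" for \<mu> :: "real ^ 'n"
    using that norm_le_l1_cart[of \<mu>] by (simp add: prob_simplex_def)
  then show "bounded (prob_simplex :: (real ^ 'n) set)"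
    by (auto simp: bounded_iff)
  have "prob_simplex = (\<Inter>i. {\<mu> :: real ^ 'n. 0 \<le> \<mu> $ i}) \<inter> {\<mu>. (\<Sum>i\<in>UNIV. \<mu> $ i) = 1}"
    by (auto simp: prob_simplex_def)
  moreover have "closed ((\<Inter>i. {\<mu> :: real ^ 'n. 0 \<le> \<mu> $ i}) \<inter> {\<mu>. (\<Sum>i\<in>UNIV. \<mu> $ i) = 1})"
    by (intro closed_Int closed_INT ballI closed_Collect_le closed_Collect_eq continuous_intros)
  ultimately show "closed (prob_simplex :: (real ^ 'n) set)"
    by (rule ssubst)
qed

text \<open>A hyperplane separates 0 from the convex set of improving directions at
  \<open>v\<close>. Monotonicity makes its normal nonnegative, and translation invariance turns the
  separation into the supergradient inequality.\<close>

lemma concave_niveloid_supergradient: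
  fixes f :: "real ^ 'n::finite \<Rightarrow> real"
  assumes f: "concave_niveloid f"
  obtains p where "p \<in> prob_simplex" "\<And>w. f w \<le> f v + p \<bullet> (w - v)"
proof -
  have mono: "f u \<le> f w" if "\<And>i. u $ i \<le> w $ i" for u w
    using f that by (simp add: concave_niveloid_def)
  have trans: "f (u + vec t) = f u + t" for u t
    using f by (simp add: concave_niveloid_def)
  define A where "A = {u. f v < f (v + u)}"
  have "convex A"
  proof (rule convexI)
    fix a b :: "real ^ 'n" and s t :: real
    assume "a \<in> A" "b \<in> A" and st: "0 \<le> s" "0 \<le> t" "s + t = 1"
    then have ab: "f v < f (v + a)" "f v < f (v + b)"
      by (auto simp: A_def)
    have "f v < s * f (v + a) + (1 - s) * f (v + b)"
    \<comment> \<open>The strict inequality is drawn from the first term when its weight is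
      positive; at \<open>s = 0\<close> it is the inequality for \<open>b\<close>.\<close>
    proof (cases "s = 0")
      case False
      then have "s * f v < s * f (v + a)" "(1 - s) * f v \<le> (1 - s) * f (v + b)"
        using ab st by (auto intro!: mult_left_mono)
      then show ?thesis by (simp add: algebra_simps)
    qed (use ab in auto)
    also have "\<dots> \<le> f (s *\<^sub>R (v + a) + (1 - s) *\<^sub>R (v + b))"
      using st by (intro concave_niveloid_mixture f) auto
    also have "s *\<^sub>R (v + a) + (1 - s) *\<^sub>R (v + b) = v + (s *\<^sub>R a + t *\<^sub>R b)"
      using st by (auto simp: algebra_simps simp flip: scaleR_add_left)
    finally show "s *\<^sub>R a + t *\<^sub>R b \<in> A"
      by (simp add: A_def)
  qed
  moreover have "0 \<notin> A"
    by (simp add: A_def)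
  ultimately obtain a where a: "a \<noteq> 0" "\<And>u. u \<in> A \<Longrightarrow> 0 \<le> a \<bullet> u"
    using separating_hyperplane_set_0 by blast
  have pos: "0 \<le> a $ i" for i
  proof (rule field_le_epsilon)
    fix e :: real assume "0 < e"
    \<comment> \<open>Moving along \<open>axis i 1\<close> alone may leave \<open>f\<close>
      unchanged. Adding \<open>vec r\<close> makes the direction strictly improving, and
      \<open>r\<close> is small enough that this changes the inner product with \<open>a\<close> by
      at most \<open>e\<close>.\<close>
    define r where "r = e / (\<bar>a \<bullet> vec 1\<bar> + 1)"
    have r: "0 < r" "r * (a \<bullet> vec 1) \<le> e"
    proof -
      show "0 < r" using \<open>0 < e\<close> by (simp add: r_def)
      have "r * (a \<bullet> vec 1) \<le> r * (\<bar>a \<bullet> vec 1\<bar> + 1)"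
        using \<open>0 < r\<close> by (intro mult_left_mono) auto
      also have "\<dots> = e" by (simp add: r_def)
      finally show "r * (a \<bullet> vec 1) \<le> e" .
    qed
    have "f v < f (v + vec r)"
      using r by (simp add: trans)
    also have "\<dots> \<le> f (v + (vec r + axis i 1))"
      by (rule mono) (simp add: axis_def)
    finally have "0 \<le> a \<bullet> (vec r + axis i 1)"
      using a by (simp add: A_def)
    moreover have "a \<bullet> vec r = r * (a \<bullet> vec 1)"
      by (simp add: inner_vec_def sum_distrib_left mult.commute)
    ultimately show "0 \<le> a $ i + e"
      using r by (simp add: inner_add_right inner_axis)
  qed
  define m where "m = (\<Sum>i\<in>UNIV. a $ i)"
  have "0 < m"
  proof -
    obtain i where "a $ i \<noteq> 0"
      using a(1) by (auto simp: vec_eq_iff)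
    then show ?thesis
      unfolding m_def using pos by (intro sum_pos2[of _ i]) (auto simp: less_le)
  qed
  define p where "p = (1 / m) *\<^sub>R a"
  have p: "p \<in> prob_simplex"
    using \<open>0 < m\<close> pos by (simp add: p_def prob_simplex_def m_def flip: sum_divide_distrib)
  have "f w \<le> f v + p \<bullet> (w - v)" for w
  proof (rule field_le_epsilon)
    fix e :: real assume "0 < e"
    \<comment> \<open>This shift lifts \<open>w\<close> to the level \<open>f v + e\<close>, just
      above that of \<open>v\<close>, so that \<open>(w - v) + vec t\<close> is an improving
      direction.\<close>
    define t where "t = f v - f w + e"
    have "f v < f (w + vec t)"
      unfolding trans using \<open>0 < e\<close> by (simp add: t_def)
    then have "(w - v) + vec t \<in> A"
      by (simp add: A_def algebra_simps)
    then have "0 \<le> p \<bullet> ((w - v) + vec t)"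
      using a(2) \<open>0 < m\<close> by (simp add: p_def)
    then have "0 \<le> p \<bullet> (w - v) + t"
      unfolding inner_add_right by (simp add: prob_simplex_inner_vec[OF p])
    then show "f w \<le> f v + p \<bullet> (w - v) + e"
      by (simp add: t_def)
  qed
  with p show ?thesis by (rule that)
qed

text \<open>Concavity at the negated points, read through oddness, is the reverse
  inequality.\<close>

lemma concave_niveloid_odd_affine:
  assumes f: "concave_niveloid f" and odd: "\<And>v. f (- v) = - f v" and \<alpha>: "\<alpha> \<in> {0..1}"
  shows "f (\<alpha> *\<^sub>R v + (1 - \<alpha>) *\<^sub>R w) = \<alpha> * f v + (1 - \<alpha>) * f w"
proof (rule antisym)
  have "\<alpha> * f (- v) + (1 - \<alpha>) * f (- w) \<le> f (\<alpha> *\<^sub>R (- v) + (1 - \<alpha>) *\<^sub>R (- w))"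
    by (rule concave_niveloid_mixture[OF f \<alpha>])
  also have "\<alpha> *\<^sub>R (- v) + (1 - \<alpha>) *\<^sub>R (- w) = - (\<alpha> *\<^sub>R v + (1 - \<alpha>) *\<^sub>R w)"
    by simp
  finally show "f (\<alpha> *\<^sub>R v + (1 - \<alpha>) *\<^sub>R w) \<le> \<alpha> * f v + (1 - \<alpha>) * f w"
    unfolding odd by simp
qed (rule concave_niveloid_mixture[OF f \<alpha>])

subsection \<open>Conjugate costs\<close>

text \<open>A lower bound together with attainment; since \<open>f\<close> is real-valued, this also
  says that the minimum is finite.\<close>

definition min_value :: "(real ^ 'n::finite \<Rightarrow> ennreal) \<Rightarrow> (real ^ 'n \<Rightarrow> real) \<Rightarrow> bool" where
  "min_value c f \<longleftrightarrow>
    (\<forall>v. \<forall>\<mu>\<in>prob_simplex. ereal (f v) \<le> ereal (\<mu> \<bullet> v) + enn2ereal (c \<mu>)) \<and>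
    (\<forall>v. \<exists>\<mu>\<in>prob_simplex. ereal (f v) = ereal (\<mu> \<bullet> v) + enn2ereal (c \<mu>))"

lemma variational_value_min_value:
  assumes "min_value c f"
  shows "variational_value \<delta> c x = ereal (f (profile \<delta> x))"
proof -
  have eq: "(\<Sum>i\<in>UNIV. (1 - \<delta> i) * discounted_sum (\<delta> i) x * \<mu> $ i) = \<mu> \<bullet> profile \<delta> x" for \<mu>
    by (simp add: inner_vec_def profile_def mult.commute)
  show ?thesis
    unfolding variational_value_def eq
    using assms by (intro Least_equality) (auto simp: min_value_def)
qed

text \<open>The cost is the concave conjugate of \<open>f\<close>: as a supremum of affine functions
  of \<open>\<mu>\<close> it is convex and lower semicontinuous. Supergradients are the minimisers,
  and the one at 0 has cost 0.\<close>

lemma conjugate_cost: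
  fixes f :: "real ^ 'n::finite \<Rightarrow> real"
  assumes f: "concave_niveloid f"
  obtains c where "grounded c" "convex_cost c" "lower_semicontinuous_cost c" "min_value c f"
proof
  \<comment> \<open>\<open>ennreal\<close> truncates negative values to 0. This does not alter the
    supremum, because the term for \<open>v = 0\<close> is already \<open>f 0 = 0\<close>.\<close>
  define c where "c \<mu> = (SUP v. ennreal (f v - \<mu> \<bullet> v))" for \<mu>
  have f0: "f 0 = 0"
    using f by (simp add: concave_niveloid_def)
  have up: "ereal (f v) \<le> ereal (\<mu> \<bullet> v) + enn2ereal (c \<mu>)" for v \<mu>
  proof -
    have "ennreal (f v - \<mu> \<bullet> v) \<le> c \<mu>"
      unfolding c_def by (rule SUP_upper) simp
    then have "enn2ereal (ennreal (f v - \<mu> \<bullet> v)) \<le> enn2ereal (c \<mu>)"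
      by (simp add: less_eq_ennreal.rep_eq)
    moreover have "ereal (f v - \<mu> \<bullet> v) \<le> enn2ereal (ennreal (f v - \<mu> \<bullet> v))"
      by (cases "0 \<le> f v - \<mu> \<bullet> v") (auto simp: enn2ereal_ennreal ennreal_neg zero_ennreal.rep_eq)
    ultimately have "ereal (f v - \<mu> \<bullet> v) \<le> enn2ereal (c \<mu>)"
      by (rule order_trans[rotated])
    then show ?thesis
      by (cases "enn2ereal (c \<mu>)") auto
  qed
  have att: "\<exists>\<mu>\<in>prob_simplex. c \<mu> = ennreal (f v - \<mu> \<bullet> v) \<and> 0 \<le> f v - \<mu> \<bullet> v" for v
  proof -
    obtain p where p: "p \<in> prob_simplex" "\<And>w. f w \<le> f v + p \<bullet> (w - v)"
      using concave_niveloid_supergradient[OF f] by blast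
    \<comment> \<open>A supergradient \<open>p\<close> at \<open>v\<close> makes \<open>v\<close> a
      maximiser of \<open>f w - p \<bullet> w\<close>. Comparison with \<open>w = 0\<close> then
      shows that the maximum is nonnegative, so nothing is truncated there.\<close>
    have "c p = ennreal (f v - p \<bullet> v)"
      unfolding c_def using p(2)
      by (intro antisym SUP_least SUP_upper ennreal_leI)
        (auto simp: inner_diff_right algebra_simps)
    then show ?thesis
      using p(1) p(2)[of 0] f0 by (auto simp: inner_diff_right)
  qed
  show "min_value c f"
    unfolding min_value_def
  proof (intro conjI allI ballI up)
    fix v
    obtain \<mu> where "\<mu> \<in> prob_simplex" "c \<mu> = ennreal (f v - \<mu> \<bullet> v)" "0 \<le> f v - \<mu> \<bullet> v"
      using att by blast
    then show "\<exists>\<mu>\<in>prob_simplex. ereal (f v) = ereal (\<mu> \<bullet> v) + enn2ereal (c \<mu>)"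
      by (intro bexI[of _ \<mu>]) (simp_all add: enn2ereal_ennreal)
  qed
  obtain \<mu>\<^sub>0 where "\<mu>\<^sub>0 \<in> prob_simplex" "c \<mu>\<^sub>0 = 0"
    using att[of 0] f0 by auto
  then show "grounded c"
    unfolding grounded_def by (metis INF_lower bot.extremum_uniqueI bot_ennreal)
  show "convex_cost c"
    unfolding convex_cost_def
  proof (intro ballI)
    fix \<mu> \<nu> :: "real ^ 'n" and \<alpha> :: real
    assume \<alpha>: "\<alpha> \<in> {0..1}"
    have "ennreal (f v - (\<alpha> *\<^sub>R \<mu> + (1 - \<alpha>) *\<^sub>R \<nu>) \<bullet> v)
        \<le> ennreal \<alpha> * c \<mu> + ennreal (1 - \<alpha>) * c \<nu>" for v
    proof -
      have "f v - (\<alpha> *\<^sub>R \<mu> + (1 - \<alpha>) *\<^sub>R \<nu>) \<bullet> v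
          = \<alpha> * (f v - \<mu> \<bullet> v) + (1 - \<alpha>) * (f v - \<nu> \<bullet> v)"
        by (simp add: inner_add_left algebra_simps)
      \<comment> \<open>Taking positive parts first mirrors the truncation and lets
        \<open>ennreal\<close> distribute over the sum.\<close>
      also have "\<dots> \<le> \<alpha> * max 0 (f v - \<mu> \<bullet> v) + (1 - \<alpha>) * max 0 (f v - \<nu> \<bullet> v)"
        using \<alpha> by (intro add_mono mult_left_mono) auto
      finally have "ennreal (f v - (\<alpha> *\<^sub>R \<mu> + (1 - \<alpha>) *\<^sub>R \<nu>) \<bullet> v)
          \<le> ennreal (\<alpha> * max 0 (f v - \<mu> \<bullet> v) + (1 - \<alpha>) * max 0 (f v - \<nu> \<bullet> v))"
        by (rule ennreal_leI)
      also have "\<dots> = ennreal \<alpha> * ennreal (f v - \<mu> \<bullet> v) + ennreal (1 - \<alpha>) * ennreal (f v - \<nu> \<bullet> v)"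
        using \<alpha> by (simp add: ennreal_plus ennreal_mult' ennreal_max_0)
      also have "\<dots> \<le> ennreal \<alpha> * c \<mu> + ennreal (1 - \<alpha>) * c \<nu>"
        unfolding c_def by (intro add_mono mult_left_mono SUP_upper) auto
      finally show ?thesis .
    qed
    then show "c (\<alpha> *\<^sub>R \<mu> + (1 - \<alpha>) *\<^sub>R \<nu>) \<le> ennreal \<alpha> * c \<mu> + ennreal (1 - \<alpha>) * c \<nu>"
      unfolding c_def[of "\<alpha> *\<^sub>R \<mu> + (1 - \<alpha>) *\<^sub>R \<nu>"] by (rule SUP_least)
  qed
  show "lower_semicontinuous_cost c"
    unfolding lower_semicontinuous_cost_def
  proof (intro ballI allI impI)
    fix \<mu> :: "real ^ 'n" and a assume "a < c \<mu>"
    \<comment> \<open>A single affine function already exceeds \<open>a\<close> at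
      \<open>\<mu>\<close>, hence also nearby by continuity, and the supremum dominates it.\<close>
    then obtain v where v: "a < ennreal (f v - \<mu> \<bullet> v)"
      unfolding c_def less_SUP_iff by blast
    have "((\<lambda>\<nu>. ennreal (f v - \<nu> \<bullet> v)) \<longlongrightarrow> ennreal (f v - \<mu> \<bullet> v)) (at \<mu> within prob_simplex)"
      by (intro tendsto_ennrealI tendsto_intros)
    then have "\<forall>\<^sub>F \<nu> in at \<mu> within prob_simplex. a < ennreal (f v - \<nu> \<bullet> v)"
      using v by (rule order_tendstoD)
    then show "\<forall>\<^sub>F \<nu> in at \<mu> within prob_simplex. a < c \<nu>"
      by eventually_elim (auto simp: c_def less_SUP_iff)
  qed
qed

section \<open>Attainment of minima by lower semicontinuous functions\<close>

lemma lower_semicontinuous_attains_inf: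
  fixes g :: "'a::topological_space \<Rightarrow> ereal"
  assumes "compact S" "S \<noteq> {}"
    and lsc: "\<And>x a. x \<in> S \<Longrightarrow> a < g x \<Longrightarrow> \<forall>\<^sub>F y in at x within S. a < g y"
  obtains x where "x \<in> S" "\<And>y. y \<in> S \<Longrightarrow> g x \<le> g y"
proof (rule ccontr)
  note that_min = that
  assume neg: "\<not> thesis"
  \<comment> \<open>Without a minimiser, each point has a neighbourhood on which \<open>g\<close>
    stays above the value at some better point \<open>y\<close>. In a finite subcover, the best of
    these chosen points lies in some covering set, and is therefore beaten by the point chosen for
    that set.\<close>
  have "\<exists>U y. open U \<and> x \<in> U \<and> y \<in> S \<and> (\<forall>z\<in>U \<inter> S. g y < g z)" if "x \<in> S" for x
  proof -
    obtain y where y: "y \<in> S" "g y < g x"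
      using neg that_min[of x] \<open>x \<in> S\<close> by (meson not_le)
    \<comment> \<open>The filter \<open>at x within S\<close> leaves out \<open>x\<close> itself,
      where \<open>y(2)\<close> supplies the inequality.\<close>
    then show ?thesis
      using lsc[OF \<open>x \<in> S\<close> y(2)] y unfolding eventually_at_topological by (metis IntE)
  qed
  then obtain U y where U: "\<And>x. x \<in> S \<Longrightarrow> open (U x) \<and> x \<in> U x \<and> y x \<in> S \<and> (\<forall>z\<in>U x \<inter> S. g (y x) < g z)"
    by metis
  obtain C where C: "C \<subseteq> S" "finite C" "S \<subseteq> (\<Union>x\<in>C. U x)"
    using compactE_image[OF \<open>compact S\<close>, of S U] U by blast
  then have "C \<noteq> {}"
    using \<open>S \<noteq> {}\<close> by auto
  then obtain x where x: "x \<in> C" "\<And>x'. x' \<in> C \<Longrightarrow> g (y x) \<le> g (y x')"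
    using ex_is_arg_min_if_finite[OF C(2), of "\<lambda>x. g (y x)"] by (auto simp: is_arg_min_linorder)
  then have "y x \<in> S"
    using U C by blast
  then obtain x' where "x' \<in> C" "y x \<in> U x'"
    using C by blast
  then have "g (y x') < g (y x)"
    using U C \<open>y x \<in> S\<close> by blast
  with x(2)[OF \<open>x' \<in> C\<close>] show False by simp
qed

text \<open>Each objective is a continuous linear function plus a lower semicontinuous cost, so it
  attains its minimum on the compact simplex. Groundedness gives a point of finite cost, which makes
  the minimum real.\<close>

lemma min_value_exists:
  fixes c :: "real ^ 'n::finite \<Rightarrow> ennreal"
  assumes gr: "grounded c" and lsc: "lower_semicontinuous_cost c"
  obtains f where "min_value c f"
proof -
  obtain \<nu> where \<nu>: "\<nu> \<in> prob_simplex" "c \<nu> < \<infinity>"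
    using gr unfolding grounded_def
    by (metis INF_less_iff ennreal_zero_less_top infinity_ennreal_def)
  have "\<exists>r. (\<forall>\<mu>\<in>prob_simplex. ereal r \<le> ereal (\<mu> \<bullet> v) + enn2ereal (c \<mu>)) \<and>
      (\<exists>\<mu>\<in>prob_simplex. ereal r = ereal (\<mu> \<bullet> v) + enn2ereal (c \<mu>))" for v
  proof -
    define g where "g \<mu> = ereal (\<mu> \<bullet> v) + enn2ereal (c \<mu>)" for \<mu>
    have "\<forall>\<^sub>F y in at \<mu> within prob_simplex. a < g y" if \<mu>: "\<mu> \<in> prob_simplex" and a: "a < g \<mu>" for \<mu> a
    proof (cases a)
      case (real a')
      then have "ereal (a' - \<mu> \<bullet> v) < enn2ereal (c \<mu>)"
        using a by (cases "enn2ereal (c \<mu>)") (auto simp: g_def)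
      \<comment> \<open>Splits the threshold \<open>a'\<close> into \<open>e\<close> for the cost
        and \<open>a' - e\<close> for the linear part; both are exceeded strictly at
        \<open>\<mu>\<close>, hence also nearby.\<close>
      then obtain e where e: "ereal (a' - \<mu> \<bullet> v) < ereal e" "ereal e < enn2ereal (c \<mu>)"
        using ereal_dense2 by blast
      have "\<forall>\<^sub>F y in at \<mu> within prob_simplex. ereal e < enn2ereal (c y)"
      \<comment> \<open>For negative \<open>e\<close> the passage to \<open>ennreal\<close> would
        truncate, but then the bound holds because costs are nonnegative.\<close>
      proof (cases "0 \<le> e")
        case True
        then have "ennreal e < c \<mu>"
          using e by (simp add: less_ennreal.rep_eq enn2ereal_ennreal)
        then have "\<forall>\<^sub>F y in at \<mu> within prob_simplex. ennreal e < c y"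
          using lsc \<mu> by (simp add: lower_semicontinuous_cost_def)
        then show ?thesis
          using True by (simp add: less_ennreal.rep_eq enn2ereal_ennreal)
      next
        case False
        then have "ereal e < enn2ereal (c y)" for y
          by (intro less_le_trans[OF _ enn2ereal_nonneg]) simp
        then show ?thesis by simp
      qed
      moreover have "((\<lambda>y. y \<bullet> v) \<longlongrightarrow> \<mu> \<bullet> v) (at \<mu> within prob_simplex)"
        by (intro tendsto_intros)
      then have "\<forall>\<^sub>F y in at \<mu> within prob_simplex. a' - e < y \<bullet> v"
        using e by (intro order_tendstoD) auto
      ultimately show ?thesis
      proof eventually_elim
        case (elim y)
        then show ?case
          using real by (cases "enn2ereal (c y)") (auto simp: g_def)
      qed
    next
      case PInf
      then show ?thesis using a by simp
    next
      case MInf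
      have "- \<infinity> < g y" for y
        using enn2ereal_nonneg[of "c y"] by (cases "enn2ereal (c y)") (auto simp: g_def)
      then show ?thesis using MInf by simp
    qed
    then obtain \<mu> where \<mu>: "\<mu> \<in> prob_simplex" "\<And>\<nu>. \<nu> \<in> prob_simplex \<Longrightarrow> g \<mu> \<le> g \<nu>"
      using lower_semicontinuous_attains_inf[OF compact_prob_simplex, of g] \<nu>(1) by blast
    have "g \<mu> \<le> g \<nu>" using \<mu> \<nu> by blast
    also have "g \<nu> < \<infinity>"
      using \<nu>(2) by (cases "c \<nu>") (auto simp: g_def enn2ereal_ennreal)
    finally have "g \<mu> < \<infinity>" .
    moreover have "g \<mu> \<noteq> - \<infinity>"
      using enn2ereal_nonneg[of "c \<mu>"] by (cases "enn2ereal (c \<mu>)") (auto simp: g_def)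
    ultimately have "ereal (real_of_ereal (g \<mu>)) = g \<mu>"
      by (cases "g \<mu>") auto
    then show ?thesis
      using \<mu> unfolding g_def by metis
  qed
  then show ?thesis
    using that unfolding min_value_def by metis
qed

section \<open>Affine majorants from points of finite cost\<close>

lemma min_value_majorant:
  assumes "min_value c f" "\<mu> \<in> prob_simplex" "c \<mu> < \<infinity>"
  obtains k where "\<And>v. f v \<le> \<mu> \<bullet> v + k"
proof
  have "enn2ereal (c \<mu>) = ereal (enn2real (c \<mu>))"
    using assms(3) by (cases "c \<mu>") (auto simp: enn2ereal_ennreal)
  then show "f v \<le> \<mu> \<bullet> v + enn2real (c \<mu>)" for v
    using assms(1,2) by (metis ereal_less_eq(3) min_value_def plus_ereal.simps(1))
qed

text \<open>A minimiser at \<open>w\<close> gives an affine majorant of \<open>f\<close> with slope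
  in the simplex that is exact at \<open>w\<close>. Its cost is finite because \<open>f w\<close> is
  real.\<close>

lemma min_value_touching:
  assumes "min_value c f"
  obtains \<mu> k where "\<mu> \<in> prob_simplex" "c \<mu> < \<infinity>" "f w = \<mu> \<bullet> w + k" "\<And>v. f v \<le> \<mu> \<bullet> v + k"
proof -
  obtain \<mu> where \<mu>: "\<mu> \<in> prob_simplex" "ereal (f w) = ereal (\<mu> \<bullet> w) + enn2ereal (c \<mu>)"
    using assms unfolding min_value_def by blast
  then have fin: "c \<mu> < \<infinity>"
    by (auto simp: less_top[symmetric] top_ennreal.rep_eq)
  then have c: "enn2ereal (c \<mu>) = ereal (enn2real (c \<mu>))"
    by (cases "c \<mu>") (auto simp: enn2ereal_ennreal)
  have "f v \<le> \<mu> \<bullet> v + enn2real (c \<mu>)" for v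
    using assms \<mu>(1) c by (metis ereal_less_eq(3) min_value_def plus_ereal.simps(1))
  then show ?thesis
    using that \<mu> fin c by simp
qed

lemma min_value_niveloid:
  fixes c :: "real ^ 'n::finite \<Rightarrow> ennreal"
  assumes gr: "grounded c" and min: "min_value c f"
  shows "concave_niveloid f"
  unfolding concave_niveloid_def
proof (intro conjI allI impI)
  show "f v \<le> f w" if le: "\<forall>i. v $ i \<le> w $ i" for v w
  proof -
    obtain \<mu> k where \<mu>: "\<mu> \<in> prob_simplex" "f w = \<mu> \<bullet> w + k" "f v \<le> \<mu> \<bullet> v + k"
      using min_value_touching[OF min] by metis
    moreover have "\<mu> \<bullet> v \<le> \<mu> \<bullet> w"
      unfolding inner_vec_def using \<mu>(1) le
      by (intro sum_mono) (auto simp: prob_simplex_def intro: mult_left_mono)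
    ultimately show ?thesis by simp
  qed
  have le: "f (v + vec t) \<le> f v + t" for v t
  proof -
    obtain \<mu> k where "\<mu> \<in> prob_simplex" "f v = \<mu> \<bullet> v + k" "f (v + vec t) \<le> \<mu> \<bullet> (v + vec t) + k"
      using min_value_touching[OF min] by metis
    then show ?thesis
      by (simp add: inner_add_right prob_simplex_inner_vec)
  qed
  show "f (v + vec t) = f v + t" for v t
  proof (rule antisym[OF le])
    \<comment> \<open>The reverse inequality is \<open>le\<close> for the opposite
      translation.\<close>
    have "v + vec t + vec (- t) = v"
      by (simp add: vec_eq_iff)
    then show "f v + t \<le> f (v + vec t)"
      using le[of "v + vec t" "- t"] by (simp only:)
  qed
  show "concave_on UNIV f"
    unfolding concave_on_iff
  proof (intro conjI ballI allI impI)
    fix v w :: "real ^ 'n" and s t :: real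
    assume st: "0 \<le> s" "0 \<le> t" "s + t = 1"
    \<comment> \<open>The majorant touching at the mixture bounds \<open>f\<close> at both
      endpoints.\<close>
    obtain \<mu> k where \<mu>: "f (s *\<^sub>R v + t *\<^sub>R w) = \<mu> \<bullet> (s *\<^sub>R v + t *\<^sub>R w) + k"
      "\<And>u. f u \<le> \<mu> \<bullet> u + k"
      using min_value_touching[OF min] by metis
    have "s * f v + t * f w \<le> s * (\<mu> \<bullet> v + k) + t * (\<mu> \<bullet> w + k)"
      using st \<mu>(2) by (intro add_mono mult_left_mono) auto
    also have "\<dots> = s * (\<mu> \<bullet> v) + t * (\<mu> \<bullet> w) + (s + t) * k"
      by (simp add: algebra_simps)
    also have "\<dots> = f (s *\<^sub>R v + t *\<^sub>R w)"
      unfolding \<mu>(1) st(3) by (simp add: inner_add_right)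
    finally show "s * f v + t * f w \<le> f (s *\<^sub>R v + t *\<^sub>R w)" .
  qed simp
  have inf: "(INF \<mu>\<in>prob_simplex. c \<mu>) = 0"
    using gr by (simp add: grounded_def)
  \<comment> \<open>\<open>ennreal\<close> is 0 at every nonpositive number, so this yields only
    \<open>f 0 \<le> 0\<close>; the other sign follows from attainment and nonnegative
    costs.\<close>
  have "ennreal (f 0) \<le> (INF \<mu>\<in>prob_simplex. c \<mu>)"
  proof (rule INF_greatest)
    fix \<mu> :: "real ^ 'n" assume "\<mu> \<in> prob_simplex"
    then have "ereal (f 0) \<le> enn2ereal (c \<mu>)"
      using min unfolding min_value_def by (metis add_0 inner_zero_right zero_ereal_def)
    then show "ennreal (f 0) \<le> c \<mu>"
      by (cases "0 \<le> f 0") (simp_all add: less_eq_ennreal.rep_eq enn2ereal_ennreal ennreal_neg zero_ennreal.rep_eq)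
  qed
  then have "f 0 \<le> 0"
    unfolding inf by (simp add: ennreal_eq_0_iff)
  moreover have "0 \<le> f 0"
  proof -
    obtain \<mu> where "ereal (f 0) = ereal (\<mu> \<bullet> 0) + enn2ereal (c \<mu>)"
      using min unfolding min_value_def by blast
    then have "ereal (f 0) = enn2ereal (c \<mu>)"
      by (simp flip: zero_ereal_def)
    then show ?thesis
      using enn2ereal_nonneg[of "c \<mu>"] by (metis ereal_less_eq(5))
  qed
  ultimately show "f 0 = 0" by simp
qed

text \<open>Two points of finite cost give majorants with different slopes, which force
  \<open>f v + f (- v)\<close> below 0 far out in a suitable direction. If only one point has finite
  cost, \<open>f\<close> is affine, and \<open>f 0 = 0\<close> makes it linear.\<close>

lemma nondegenerate_iff_not_odd:
  assumes min: "min_value c f" and "f 0 = 0"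
  shows "nondegenerate c \<longleftrightarrow> (\<exists>v. f (- v) \<noteq> - f v)"
proof
  assume "nondegenerate c"
  then obtain \<mu> \<nu> where \<mu>\<nu>: "\<mu> \<in> prob_simplex" "\<nu> \<in> prob_simplex" "\<mu> \<noteq> \<nu>" "c \<mu> < \<infinity>" "c \<nu> < \<infinity>"
    unfolding nondegenerate_def by blast
  obtain k where k: "\<And>v. f v \<le> \<mu> \<bullet> v + k"
    using min_value_majorant[OF min \<mu>\<nu>(1,4)] by blast
  obtain l where l: "\<And>v. f v \<le> \<nu> \<bullet> v + l"
    using min_value_majorant[OF min \<mu>\<nu>(2,5)] by blast
  define n where "n = (\<mu> - \<nu>) \<bullet> (\<mu> - \<nu>)"
  \<comment> \<open>Chosen so that \<open>s * n\<close> exceeds \<open>k + l\<close>, the sum of the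
    two intercepts.\<close>
  define s where "s = (\<bar>k + l\<bar> + 1) / n"
  have "0 < n"
    using \<open>\<mu> \<noteq> \<nu>\<close> by (simp add: n_def)
  have "f ((- s) *\<^sub>R (\<mu> - \<nu>)) + f (- ((- s) *\<^sub>R (\<mu> - \<nu>))) \<le> - (s * n) + (k + l)"
    using k[of "(- s) *\<^sub>R (\<mu> - \<nu>)"] l[of "- ((- s) *\<^sub>R (\<mu> - \<nu>))"]
    by (simp add: n_def inner_diff_left inner_diff_right algebra_simps)
  also have "s * n = \<bar>k + l\<bar> + 1"
    using \<open>0 < n\<close> by (simp add: s_def)
  finally have "f ((- s) *\<^sub>R (\<mu> - \<nu>)) + f (- ((- s) *\<^sub>R (\<mu> - \<nu>))) < 0"
    by linarith
  then show "\<exists>v. f (- v) \<noteq> - f v"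
    by (metis add.right_inverse less_irrefl)
next
  assume "\<exists>v. f (- v) \<noteq> - f v"
  then obtain v where v: "f (- v) \<noteq> - f v" ..
  show "nondegenerate c"
  proof (rule ccontr)
    assume nd: "\<not> nondegenerate c"
    obtain p where p: "p \<in> prob_simplex" "c p < \<infinity>"
      using min_value_touching[OF min] by metis
    \<comment> \<open>Every minimiser has finite cost and therefore coincides with
      \<open>p\<close>.\<close>
    have eq: "ereal (f w) = ereal (p \<bullet> w) + enn2ereal (c p)" for w
    proof -
      obtain \<mu> where \<mu>: "\<mu> \<in> prob_simplex" "ereal (f w) = ereal (\<mu> \<bullet> w) + enn2ereal (c \<mu>)"
        using min unfolding min_value_def by blast
      then have "c \<mu> < \<infinity>"
        by (auto simp: less_top[symmetric] top_ennreal.rep_eq)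
      then have "\<mu> = p"
        using nd \<mu>(1) p by (auto simp: nondegenerate_def)
      then show ?thesis using \<mu>(2) by simp
    qed
    have "enn2ereal (c p) = 0"
      using eq[of 0] \<open>f 0 = 0\<close> by (simp flip: zero_ereal_def)
    then have "f w = p \<bullet> w" for w
      using eq[of w] by simp
    with v show False by simp
  qed
qed

subsection \<open>Preferences represented by concave niveloids\<close>

lemma bounded_linear_constant_stream: "bounded_linear constant_stream"
  by (rule bounded_linear_intro[where K = 1])
    (auto intro!: bcontfun_eqI norm_bound simp: const_bcontfun.rep_eq)

lemma concave_niveloid_preference:
  fixes \<delta> :: "'n::finite \<Rightarrow> real"
  assumes D: "range \<delta> \<subseteq> {0<..<1}" and "inj \<delta>"
    and f: "concave_niveloid f" and not_odd: "f (- v) \<noteq> - f v"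
    and R: "\<And>x y. R x y \<longleftrightarrow> f (profile \<delta> y) \<le> f (profile \<delta> x)"
  shows "D_monotonicity_a (range \<delta>) R" "continuity R" "convexity_a R" "convexity_b R"
    "common_origin_invariance R"
proof -
  interpret P: bounded_linear "profile \<delta>"
    by (rule bounded_linear_profile[OF D])
  note P_const = profile_constant_stream[OF D]
  obtain S where S: "\<And>v. profile \<delta> (S v) = v"
    using profile_section[OF D \<open>inj \<delta>\<close>] by metis
  have trans: "f (u + vec t) = f u + t" and f0: "f 0 = 0" for u t
    using f by (simp_all add: concave_niveloid_def)
  show "D_monotonicity_a (range \<delta>) R"
    unfolding D_monotonicity_a_def
  proof (intro allI impI)
    fix x y assume le: "\<forall>d\<in>range \<delta>. discounted_sum d y \<le> discounted_sum d x"
    have "\<delta> i \<le> 1" for i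
      using D by (auto simp: image_subset_iff less_imp_le)
    then have "profile \<delta> y $ i \<le> profile \<delta> x $ i" for i
      using le by (simp add: profile_def mult_left_mono)
    then show "R x y"
      unfolding R using f by (simp add: concave_niveloid_def)
  qed
  \<comment> \<open>A convex function on the whole of a finite-dimensional space is
    continuous.\<close>
  have "continuous_on UNIV (\<lambda>v. - f v)"
    using f by (intro convex_on_continuous) (auto simp: concave_niveloid_def concave_on_def)
  then have "continuous_on UNIV (\<lambda>v. - (- f v))"
    by (rule continuous_on_minus)
  then have "continuous_on UNIV f" by simp
  then have cont: "continuous_on UNIV (\<lambda>x. f (profile \<delta> x))"
    by (rule continuous_on_compose2) (auto intro: P.continuous_on continuous_intros)
  show "continuity R"
    unfolding continuity_def R by (auto intro!: closed_Collect_le cont continuous_intros)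
  show "convexity_a R"
    unfolding convexity_a_def indifference_def R
  proof (intro allI impI ballI)
    fix x y \<alpha>
    assume "f (profile \<delta> y) \<le> f (profile \<delta> x) \<and> f (profile \<delta> x) \<le> f (profile \<delta> y)"
    then have "f (profile \<delta> y) = f (profile \<delta> x)" by simp
    moreover assume "\<alpha> \<in> {0..1::real}"
    ultimately show "f (profile \<delta> x) \<le> f (profile \<delta> (\<alpha> *\<^sub>R x + (1 - \<alpha>) *\<^sub>R y))"
      using concave_niveloid_mixture[OF f, of \<alpha> "profile \<delta> x" "profile \<delta> y"]
      by (simp add: P.add P.scaleR flip: distrib_right)
  qed
  show "common_origin_invariance R"
    unfolding common_origin_invariance_def R by (simp add: P.add P_const trans)
  show "convexity_b R"
  proof -
    \<comment> \<open>Both streams are shifted to level 0, which makes them indifferent. The profile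
      of their midpoint is constant with value \<open>- (f v + f (- v)) / 2\<close>, and concavity
      together with failure of oddness makes this positive.\<close>
    define x where "x = S v + constant_stream (- f v)"
    define y where "y = S (- v) + constant_stream (- f (- v))"
    have x: "f (profile \<delta> x) = 0" and y: "f (profile \<delta> y) = 0"
      unfolding x_def y_def P.add P_const S trans by simp_all
    have "f v + f (- v) \<le> 0"
      using concave_niveloid_mixture[OF f, of "1/2" v "- v"] by (simp add: f0)
    then have neg: "f v + f (- v) < 0"
      using not_odd by linarith
    have "profile \<delta> ((1/2) *\<^sub>R x + (1 - 1/2) *\<^sub>R y) = 0 + vec (- (f v + f (- v)) / 2)"
      unfolding x_def y_def P.add P.scaleR P_const S by (simp add: vec_eq_iff field_simps)
    then have "f (profile \<delta> ((1/2) *\<^sub>R x + (1 - 1/2) *\<^sub>R y)) = - (f v + f (- v)) / 2"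
      unfolding trans[of 0] f0 by (simp only: trans f0)
    then have "indifference R x y \<and> strict_part R ((1/2) *\<^sub>R x + (1 - 1/2) *\<^sub>R y) x"
      unfolding indifference_def strict_part_def R x y using neg by simp
    moreover have "1/2 \<in> {0<..<1::real}" by simp
    ultimately show ?thesis
      unfolding convexity_b_def by blast
  qed
qed

text \<open>Every stream is indifferent to exactly one constant stream. This certainty equivalent
  represents \<open>R\<close> and factors through the profile; the factor is
  \<open>f\<close>.\<close>

lemma preference_concave_niveloid:
  fixes \<delta> :: "'n::finite \<Rightarrow> real"
  assumes D: "range \<delta> \<subseteq> {0<..<1}" and "inj \<delta>" and "weak_order R"
    and mon: "D_monotonicity_a (range \<delta>) R" and cont: "continuity R"
    and cvx_a: "convexity_a R" and cvx_b: "convexity_b R" and inv: "common_origin_invariance R"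
  obtains f v where "concave_niveloid f" "f (- v) \<noteq> - f v"
    "\<And>x y. R x y \<longleftrightarrow> f (profile \<delta> y) \<le> f (profile \<delta> x)"
proof -
  interpret P: bounded_linear "profile \<delta>"
    by (rule bounded_linear_profile[OF D])
  interpret C: bounded_linear constant_stream
    by (rule bounded_linear_constant_stream)
  note P_const = profile_constant_stream[OF D]
  obtain S where S: "\<And>v. profile \<delta> (S v) = v"
    using profile_section[OF D \<open>inj \<delta>\<close>] by metis
  have total: "R x y \<or> R y x" and R_trans: "R x y \<Longrightarrow> R y z \<Longrightarrow> R x z" for x y z
    using \<open>weak_order R\<close> unfolding weak_order_def by (auto dest: transpD)
  have mono: "R x y" if "\<And>i. profile \<delta> y $ i \<le> profile \<delta> x $ i" for x y
  proof -
    have "0 < 1 - \<delta> i" for i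
      using D by (auto simp: image_subset_iff)
    then have "discounted_sum (\<delta> i) y \<le> discounted_sum (\<delta> i) x" for i
      using that[of i] by (simp add: profile_def)
    then show ?thesis
      using mon by (auto simp: D_monotonicity_a_def)
  qed
  have shift: "R (x + constant_stream t) (y + constant_stream t) \<longleftrightarrow> R x y" for x y t
    using inv by (auto simp: common_origin_invariance_def)
  define B where "B x = norm (profile \<delta> x)" for x
  have upper: "R (constant_stream (B x)) x" and lower: "R x (constant_stream (- B x))" for x
    using component_le_norm_cart[of "profile \<delta> x"]
    by (auto intro!: mono simp: P_const B_def abs_le_iff minus_le_iff)
  \<comment> \<open>If a constant were weakly preferred to a larger one, invariance would allow the
    step to be repeated, so every constant would be weakly preferred to every other. The bounds
    \<open>upper\<close> and \<open>lower\<close> extend this to all streams, against convexity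
    (b).\<close>
  have strict: "t \<le> s" if "R (constant_stream s) (constant_stream t)" for s t
  proof (rule ccontr)
    assume "\<not> t \<le> s"
    define e where "e = t - s"
    have "e > 0" using \<open>\<not> t \<le> s\<close> by (simp add: e_def)
    have step: "R (constant_stream a) (constant_stream (a + e))" for a
      using that shift[of "constant_stream s" "a - s" "constant_stream t"]
      by (simp add: e_def algebra_simps flip: C.add)
    have iter: "R (constant_stream a) (constant_stream (a + real n * e))" for a n
    proof (induction n)
      case 0
      then show ?case using total by auto
    next
      case (Suc n)
      then show ?case
        using R_trans[OF Suc step[of "a + real n * e"]] by (simp add: algebra_simps)
    qed
    have all: "R (constant_stream a) (constant_stream b)" for a b
    proof -
      obtain n where "b - a < real n * e"
        using reals_Archimedean3[OF \<open>e > 0\<close>] by blast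
      then have "R (constant_stream (a + real n * e)) (constant_stream b)"
        by (intro mono) (simp add: P_const)
      with iter show ?thesis by (rule R_trans)
    qed
    have "R x y" for x y
      using R_trans[OF lower R_trans[OF all upper]] .
    then show False
      using cvx_b by (auto simp: convexity_b_def strict_part_def)
  qed
  have "\<exists>t. R x (constant_stream t) \<and> R (constant_stream t) x" for x
  proof (rule ccontr)
    assume none: "\<not> ?thesis"
    \<comment> \<open>The levels weakly above and weakly below \<open>x\<close> form two nonempty
      closed sets covering the line, so connectedness makes them meet.\<close>
    have "continuous_on UNIV constant_stream"
      by (intro C.continuous_on continuous_intros)
    then have "closed (constant_stream -` {z. R x z})" "closed (constant_stream -` {z. R z x})"
      using cont unfolding continuity_def by (metis closed_vimage)+
    moreover have "constant_stream -` {z. R x z} \<inter> constant_stream -` {z. R z x} = {}"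
      "UNIV \<subseteq> constant_stream -` {z. R x z} \<union> constant_stream -` {z. R z x}"
      "- B x \<in> constant_stream -` {z. R x z}" "B x \<in> constant_stream -` {z. R z x}"
      using none total lower upper by auto
    ultimately show False
      using connected_UNIV[where 'a = real] unfolding connected_closed by blast
  qed
  then obtain u where u: "\<And>x. R x (constant_stream (u x))" "\<And>x. R (constant_stream (u x)) x"
    by metis
  have Ru: "R x y \<longleftrightarrow> u y \<le> u x" for x y
  proof
    assume "R x y"
    show "u y \<le> u x"
      using R_trans[OF u(2)[of x] R_trans[OF \<open>R x y\<close> u(1)[of y]]] by (rule strict)
  next
    assume "u y \<le> u x"
    then have le: "R (constant_stream (u x)) (constant_stream (u y))"
      by (intro mono) (simp add: P_const)
    show "R x y"
      using R_trans[OF u(1)[of x] R_trans[OF le u(2)[of y]]] .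
  qed
  have u_mono: "u x \<le> u y" if "\<And>i. profile \<delta> x $ i \<le> profile \<delta> y $ i" for x y
    using mono[OF that] by (simp add: Ru)
  have u_const: "u (constant_stream t) = t" for t
    using u[of "constant_stream t"] strict by (intro antisym) auto
  have u_shift: "u (x + constant_stream t) = u x + t" for x t
  proof -
    have "u (x + constant_stream t) = u (constant_stream (u x) + constant_stream t)"
      using u[of x] shift unfolding Ru by (intro antisym) auto
    then show ?thesis
      by (simp add: u_const flip: C.add)
  qed
  \<comment> \<open>The choice of section is immaterial: \<open>S (profile \<delta> x)\<close> and
    \<open>x\<close> have the same profile, hence the same certainty equivalent.\<close>
  define f where "f v = u (S v)" for v
  have fu: "f (profile \<delta> x) = u x" for x
    unfolding f_def by (intro antisym u_mono) (simp_all add: S)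
  have uf: "u x = f (profile \<delta> x)" for x
    by (simp add: fu)
  have f: "concave_niveloid f"
    unfolding concave_niveloid_def
  proof (intro conjI allI impI)
    show "f v \<le> f w" if "\<forall>i. v $ i \<le> w $ i" for v w
      unfolding f_def using that by (intro u_mono) (simp add: S)
    show f_shift: "f (v + vec t) = f v + t" for v t
      using u_shift[of "S v" t] by (simp add: uf P.add P_const S)
    show "f 0 = 0"
      using u_const[of 0] by (simp add: uf C.zero P.zero)
    show "concave_on UNIV f"
      unfolding concave_on_iff
    proof (intro conjI ballI allI impI)
      fix v w :: "real ^ 'n" and s t :: real
      assume st: "0 \<le> s" "0 \<le> t" "s + t = 1"
      \<comment> \<open>Convexity (a) speaks only of indifferent streams, so both are first
        translated to level 0. Translating back turns it into concavity.\<close>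
      define x where "x = S v + constant_stream (- f v)"
      define y where "y = S w + constant_stream (- f w)"
      have x: "u x = 0" and y: "u y = 0"
        by (simp_all add: x_def y_def u_shift f_def)
      have "R (s *\<^sub>R x + (1 - s) *\<^sub>R y) x"
        using cvx_a[unfolded convexity_a_def, rule_format, of x y s] st
        by (simp add: indifference_def Ru x y)
      then have "0 \<le> f (profile \<delta> (s *\<^sub>R x + (1 - s) *\<^sub>R y))"
        by (simp add: Ru x fu)
      also have "1 - s = t" using st by simp
      also have "profile \<delta> (s *\<^sub>R x + t *\<^sub>R y) = s *\<^sub>R v + t *\<^sub>R w + vec (- (s * f v + t * f w))"
        unfolding x_def y_def P.add P.scaleR P_const S by (simp add: vec_eq_iff algebra_simps)
      finally show "s * f v + t * f w \<le> f (s *\<^sub>R v + t *\<^sub>R w)"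
        unfolding f_shift by simp
    qed simp
  qed
  obtain x y \<alpha> where xy: "indifference R x y" "\<alpha> \<in> {0<..<1}"
    "strict_part R (\<alpha> *\<^sub>R x + (1 - \<alpha>) *\<^sub>R y) x"
    using cvx_b unfolding convexity_b_def by blast
  \<comment> \<open>An odd \<open>f\<close> would be affine, and then no mixture of indifferent
    streams could be strictly better, contrary to convexity (b).\<close>
  have "\<exists>v. f (- v) \<noteq> - f v"
  proof (rule ccontr)
    assume "\<not> ?thesis"
    then have "f (\<alpha> *\<^sub>R profile \<delta> x + (1 - \<alpha>) *\<^sub>R profile \<delta> y)
        = \<alpha> * f (profile \<delta> x) + (1 - \<alpha>) * f (profile \<delta> y)"
      using xy(2) by (intro concave_niveloid_odd_affine f) auto
    moreover have "f (profile \<delta> y) = f (profile \<delta> x)"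
      using xy(1) by (simp add: indifference_def Ru fu)
    ultimately have "f (profile \<delta> (\<alpha> *\<^sub>R x + (1 - \<alpha>) *\<^sub>R y)) = f (profile \<delta> x)"
      by (simp add: P.add P.scaleR left_diff_distrib)
    with xy(3) show False
      by (simp add: strict_part_def Ru fu)
  qed
  with f show ?thesis
    using that Ru by (auto simp: uf)
qed

theorem theorem3p1:
  fixes \<delta> :: "'n::finite \<Rightarrow> real" and D :: "real set" and R :: preference
  assumes "D = range \<delta>" and "inj \<delta>" and "D \<subseteq> {0<..<1}" and "weak_order R"
  shows "(D_monotonicity_a D R \<and> continuity R \<and> convexity_a R \<and> convexity_b R \<and>
            common_origin_invariance R)
      \<longleftrightarrow> (\<exists>c :: real ^ 'n \<Rightarrow> ennreal.
            grounded c \<and> convex_cost c \<and> lower_semicontinuous_cost c \<and> nondegenerate c \<and>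
            (\<forall>x y. R x y \<longleftrightarrow> variational_value \<delta> c x \<ge> variational_value \<delta> c y))"
proof -
  have D: "range \<delta> \<subseteq> {0<..<1}"
    using assms by simp
  show ?thesis
  proof
    assume "D_monotonicity_a D R \<and> continuity R \<and> convexity_a R \<and> convexity_b R \<and>
      common_origin_invariance R"
    then obtain f v where f: "concave_niveloid f" "f (- v) \<noteq> - f v"
      "\<And>x y. R x y \<longleftrightarrow> f (profile \<delta> y) \<le> f (profile \<delta> x)"
      using preference_concave_niveloid[OF D \<open>inj \<delta>\<close> \<open>weak_order R\<close>] assms(1) by metis
    obtain c where c: "grounded c" "convex_cost c" "lower_semicontinuous_cost c" "min_value c f"
      using conjugate_cost[OF f(1)] .
    have "nondegenerate c"
      using nondegenerate_iff_not_odd[OF c(4)] f(1,2) by (auto simp: concave_niveloid_def)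
    with c f(3) show "\<exists>c :: real ^ 'n \<Rightarrow> ennreal.
        grounded c \<and> convex_cost c \<and> lower_semicontinuous_cost c \<and> nondegenerate c \<and>
        (\<forall>x y. R x y \<longleftrightarrow> variational_value \<delta> c x \<ge> variational_value \<delta> c y)"
      by (intro exI[of _ c]) (simp add: variational_value_min_value)
  next
    assume "\<exists>c :: real ^ 'n \<Rightarrow> ennreal.
        grounded c \<and> convex_cost c \<and> lower_semicontinuous_cost c \<and> nondegenerate c \<and>
        (\<forall>x y. R x y \<longleftrightarrow> variational_value \<delta> c x \<ge> variational_value \<delta> c y)"
    then obtain c :: "real ^ 'n \<Rightarrow> ennreal" where
      c: "grounded c" "lower_semicontinuous_cost c" "nondegenerate c"
      "\<And>x y. R x y \<longleftrightarrow> variational_value \<delta> c x \<ge> variational_value \<delta> c y"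
      by blast
    obtain f where min: "min_value c f"
      using min_value_exists[OF c(1,2)] .
    have f: "concave_niveloid f"
      by (rule min_value_niveloid[OF c(1) min])
    then obtain v where v: "f (- v) \<noteq> - f v"
      using nondegenerate_iff_not_odd[OF min] c(3) by (auto simp: concave_niveloid_def)
    have "R x y \<longleftrightarrow> f (profile \<delta> y) \<le> f (profile \<delta> x)" for x y
      by (simp add: c(4) variational_value_min_value[OF min])
    from concave_niveloid_preference[OF D \<open>inj \<delta>\<close> f v this]
    show "D_monotonicity_a D R \<and> continuity R \<and> convexity_a R \<and> convexity_b R \<and>
        common_origin_invariance R"
      using assms(1) by simp
  qed
qed

end
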